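(* Let $x_0\in\mathcal{B}(r)$, $x_0\neq0$, and let $J_{\mathrm{OPT}}=x_0'Px_0$, where $P\succ0$ is the stabilizing solution of $A'P+PA+\tilde Q-PB\tilde R^{-1}B'P=0$. (1) Let $\alpha\in\mathcal{A}$ and suppose that the algebraic Riccati equation $A'P_\alpha+P_\alpha A+Q_\alpha-P_\alpha BR_\alpha^{-1}B'P_\alpha=0$ has a stabilizing solution $P_\alpha\succ0$ (that is, $A-BR_\alpha^{-1}B'P_\alpha$ is Hurwitz) which satisfies $G_iR_\alpha^{-1}B'P_\alpha\bigl(I_n-C_i'(C_iC_i')^{-1}C_i\bigr)=0$ for all $i\in\mathsf N$. Let $F^\star=-R_\alpha^{-1}B'P_\alpha$ denote the corresponding output feedback Pareto optimal gain. Then $$\eta_1(F^\star):=\frac{\sum_{i\in\mathsf N}J_i(x_0,F^\star)}{J_{\mathrm{OPT}}}\ge1.$$ (2) Let $\alpha\in\mathcal{A}$ and $\delta>0$. Suppose there exists a structured feedback gain $F_{\mathrm s}\in\mathbb{R}^{m\times n}$ that satisfies SC$_2$, such that $J_\alpha(z,F_{\mathrm s})<\delta$ for all $z\in\mathcal{B}(r)$ and $A+BF_{\mathrm s}$ is Hurwitz. Then $$\eta_2(F_{\mathrm s}):=\frac{\sum_{i\in\mathsf N}J_i(x_0,F_{\mathrm s})}{J_{\mathrm{OPT}}}\ge1.$$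
   Context: Notation: $'$ denotes transpose; $M\succ0$ (resp. $M\succeq 0$) means symmetric positive definite (resp. semidefinite); $\oplus$ is the block-diagonal direct sum of matrices; a square real matrix is Hurwitz if all its eigenvalues have negative real part; $\mathcal{B}(r)=\{z\in\mathbb{R}^n : \|z\|\le r\}$ for a given fixed $r>0$. Setting: $\mathsf N=\{1,\dots,N\}$ is a set of players. The data are $A\in\mathbb{R}^{n\times n}$, $B_i\in\mathbb{R}^{n\times m_i}$, $C_i\in\mathbb{R}^{s_i\times n}$ with $\mathrm{rank}(C_i)=s_i\le n$, $Q_i\in\mathbb{R}^{s_i\times s_i}$ with $Q_i\succeq0$, and $R_i\in\mathbb{R}^{m_i\times m_i}$ with $R_i\succ0$, $i\in\mathsf N$. Let $m=m_1+\cdots+m_N$ and $B=[B_1\ B_2\ \cdots\ B_N]\in\mathbb{R}^{n\times m}$; $(A,B)$ is assumed stabilizable. Let $G_i=[0_{m_i\times m_1}\ \cdots\ I_{m_i}\ \cdots\ 0_{m_i\times m_N}]\in\mathbb{R}^{m_i\times m}$ (identity in the $i$-th block). Weights: $\mathcal{A}=\{\alpha=(\alpha_1,\dots,\alpha_N) : \alpha_i\in(0,1),\ \sum_{i\in\mathsf N}\alpha_i=1\}$. For $\alpha\in\mathcal{A}$ let $Q_\alpha=\sum_{i\in\mathsf N}C_i'(\alpha_iQ_i)C_i$ and $R_\alpha=\oplus_{i\in\mathsf N}\alpha_iR_i\in\mathbb{R}^{m\times m}$. Let $\tilde Q=\sum_{i\in\mathsf N}C_i'Q_iC_i$ and $\tilde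 R=\oplus_{i\in\mathsf N}R_i$. Costs: for $F\in\mathbb{R}^{m\times n}$ and $x_0\in\mathbb{R}^n$, let $x(t)$ solve $\dot x=(A+BF)x$, $x(0)=x_0$, let $u(t)=Fx(t)$ and $u_i(t)=G_iFx(t)$. Player $i$'s cost is $J_i(x_0,F)=\int_0^\infty (x(t)'C_i'Q_iC_ix(t)+u_i(t)'R_iu_i(t))\,dt\in[0,\infty]$, and $J_\alpha(x_0,F)=\sum_{i\in\mathsf N}\alpha_iJ_i(x_0,F)=\int_0^\infty (x(t)'Q_\alpha x(t)+u(t)'R_\alpha u(t))\,dt$. Structural condition SC$_2$: $F\in\mathbb{R}^{m\times n}$ satisfies SC$_2$ if $G_iF\bigl(I_n-C_i'(C_iC_i')^{-1}C_i\bigr)=0$ for all $i\in\mathsf N$. Optimal cooperative cost: it is a standing assumption that the Riccati equation $A'P+PA+\tilde Q-PB\tilde R^{-1}B'P=0$ has a (unique) stabilizing solution $P\succ0$, i.e. with $A-B\tilde R^{-1}B'P$ Hurwitz; the optimal cooperative cost for initial condition $x_0$ is $J_{\mathrm{OPT}}=x_0'Px_0$. *)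

theory Defs
  imports
    "HOL-Analysis.Analysis"
    "Jordan_Normal_Form.Gauss_Jordan_Elimination"
    "Jordan_Normal_Form.Char_Poly"
    "Jordan_Normal_Form.DL_Rank"
begin

(* HOL-Analysis and Jordan_Normal_Form both use these notations; the latter's are meant below. *)
unbundle no vec_syntax
unbundle no inner_syntax

type_synonym rmat = "real Matrix.mat"
type_synonym rvec = "real Matrix.vec"

definition quad_form :: "rmat \<Rightarrow> rvec \<Rightarrow> real" where
  "quad_form M v = v \<bullet> (M *\<^sub>v v)"

definition pos_def :: "nat \<Rightarrow> rmat \<Rightarrow> bool" where
  "pos_def n M \<longleftrightarrow> M \<in> carrier_mat n n \<and> transpose_mat M = M \<and>
     (\<forall>v \<in> carrier_vec n. v \<noteq> 0\<^sub>v n \<longrightarrow> quad_form M v > 0)"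

definition pos_semidef :: "nat \<Rightarrow> rmat \<Rightarrow> bool" where
  "pos_semidef n M \<longleftrightarrow> M \<in> carrier_mat n n \<and> transpose_mat M = M \<and>
     (\<forall>v \<in> carrier_vec n. quad_form M v \<ge> 0)"

(* Eigenvalues of a real matrix are its complex eigenvalues. *)
definition hurwitz :: "rmat \<Rightarrow> bool" where
  "hurwitz M \<longleftrightarrow>
     (\<forall>z. eigenvalue (map_mat complex_of_real M) z \<longrightarrow> Re z < 0)"

(* Only meaningful for invertible M; on these mat_inverse returns Some of the two-sided inverse. *)
definition minv :: "rmat \<Rightarrow> rmat" where
  "minv M = the (mat_inverse M)"

definition vball :: "nat \<Rightarrow> real \<Rightarrow> rvec set" where
  "vball n r = {z \<in> carrier_vec n. sqrt (z \<bullet> z) \<le> r}"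

(* [M_1 M_2 ... M_k] for matrices with n rows each; the zero blocks have no rows. *)
fun hconcat_mat :: "nat \<Rightarrow> rmat list \<Rightarrow> rmat" where
  "hconcat_mat n [] = 0\<^sub>m n 0"
| "hconcat_mat n (M # Ms) =
     four_block_mat M (hconcat_mat n Ms)
       (0\<^sub>m 0 (dim_col M)) (0\<^sub>m 0 (dim_col (hconcat_mat n Ms)))"

(* Players are 1,...,N; families indexed by players are functions on nat, of which
   only the values at 1,...,N matter. *)

definition input_dim :: "nat \<Rightarrow> (nat \<Rightarrow> nat) \<Rightarrow> nat" where
  "input_dim N m = (\<Sum>i = 1..N. m i)"

definition joint_B :: "nat \<Rightarrow> nat \<Rightarrow> (nat \<Rightarrow> rmat) \<Rightarrow> rmat" where
  "joint_B N n B = hconcat_mat n (map B [1..<Suc N])"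

definition selector :: "nat \<Rightarrow> (nat \<Rightarrow> nat) \<Rightarrow> nat \<Rightarrow> rmat" where
  "selector N m i =
     hconcat_mat (m i) (map (\<lambda>j. if j = i then 1\<^sub>m (m i) else 0\<^sub>m (m i) (m j)) [1..<Suc N])"

definition stabilizable :: "nat \<Rightarrow> nat \<Rightarrow> rmat \<Rightarrow> rmat \<Rightarrow> bool" where
  "stabilizable n k A B \<longleftrightarrow> (\<exists>F \<in> carrier_mat k n. hurwitz (A + B * F))"

definition weights :: "nat \<Rightarrow> (nat \<Rightarrow> real) set" where
  "weights N = {\<alpha>. (\<forall>i \<in> {1..N}. 0 < \<alpha> i \<and> \<alpha> i < 1) \<and> (\<Sum>i = 1..N. \<alpha> i) = 1}"

definition Q_weighted ::
  "nat \<Rightarrow> nat \<Rightarrow> (nat \<Rightarrow> rmat) \<Rightarrow> (nat \<Rightarrow> rmat) \<Rightarrow> (nat \<Rightarrow> real) \<Rightarrow> rmat" where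
  "Q_weighted N n C Q \<alpha> = Matrix.mat n n (\<lambda>kl.
     \<Sum>i = 1..N. (transpose_mat (C i) * (\<alpha> i \<cdot>\<^sub>m Q i) * C i) $$ kl)"

definition R_weighted :: "nat \<Rightarrow> (nat \<Rightarrow> rmat) \<Rightarrow> (nat \<Rightarrow> real) \<Rightarrow> rmat" where
  "R_weighted N R \<alpha> = diag_block_mat (map (\<lambda>i. \<alpha> i \<cdot>\<^sub>m R i) [1..<Suc N])"

definition Q_coop :: "nat \<Rightarrow> nat \<Rightarrow> (nat \<Rightarrow> rmat) \<Rightarrow> (nat \<Rightarrow> rmat) \<Rightarrow> rmat" where
  "Q_coop N n C Q = Matrix.mat n n (\<lambda>kl.
     \<Sum>i = 1..N. (transpose_mat (C i) * Q i * C i) $$ kl)"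

definition R_coop :: "nat \<Rightarrow> (nat \<Rightarrow> rmat) \<Rightarrow> rmat" where
  "R_coop N R = diag_block_mat (map R [1..<Suc N])"

definition stabilizing_are_solution :: "nat \<Rightarrow> rmat \<Rightarrow> rmat \<Rightarrow> rmat \<Rightarrow> rmat \<Rightarrow> rmat \<Rightarrow> bool" where
  "stabilizing_are_solution n A B Q R P \<longleftrightarrow>
     transpose_mat A * P + P * A + Q - P * B * minv R * transpose_mat B * P = 0\<^sub>m n n \<and>
     hurwitz (A - B * minv R * transpose_mat B * P)"

definition linear_ode_solution :: "nat \<Rightarrow> rmat \<Rightarrow> rvec \<Rightarrow> (real \<Rightarrow> rvec) \<Rightarrow> bool" where
  "linear_ode_solution n M x0 x \<longleftrightarrow>
     x 0 = x0 \<and>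
     (\<forall>t \<ge> 0. x t \<in> carrier_vec n \<and>
        (\<forall>k < n. ((\<lambda>\<tau>. x \<tau> $ k) has_real_derivative (M *\<^sub>v x t) $ k) (at t within {0..})))"

(* A solution exists and is unique on t >= 0; the values for t < 0 are arbitrary and never used. *)
definition trajectory :: "nat \<Rightarrow> rmat \<Rightarrow> rvec \<Rightarrow> real \<Rightarrow> rvec" where
  "trajectory n M x0 = (SOME x. linear_ode_solution n M x0 x)"

(* The integrand is nonnegative for Q i positive semidefinite and R i positive definite,
   so ennreal does not truncate it. *)
definition player_cost ::
  "nat \<Rightarrow> nat \<Rightarrow> (nat \<Rightarrow> nat) \<Rightarrow> rmat \<Rightarrow> (nat \<Rightarrow> rmat) \<Rightarrow> (nat \<Rightarrow> rmat) \<Rightarrow> (nat \<Rightarrow> rmat) \<Rightarrow>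
   (nat \<Rightarrow> rmat) \<Rightarrow> nat \<Rightarrow> rvec \<Rightarrow> rmat \<Rightarrow> ennreal" where
  "player_cost N n m A B C Q R i x0 F =
     (let x = trajectory n (A + joint_B N n B * F) x0;
          u = (\<lambda>t. selector N m i * F *\<^sub>v x t)
      in \<integral>\<^sup>+t\<in>{0..}. ennreal (quad_form (transpose_mat (C i) * Q i * C i) (x t)
                            + quad_form (R i) (u t)) \<partial>lborel)"

definition weighted_cost ::
  "nat \<Rightarrow> nat \<Rightarrow> (nat \<Rightarrow> nat) \<Rightarrow> rmat \<Rightarrow> (nat \<Rightarrow> rmat) \<Rightarrow> (nat \<Rightarrow> rmat) \<Rightarrow> (nat \<Rightarrow> rmat) \<Rightarrow>
   (nat \<Rightarrow> rmat) \<Rightarrow> (nat \<Rightarrow> real) \<Rightarrow> rvec \<Rightarrow> rmat \<Rightarrow> ennreal" where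
  "weighted_cost N n m A B C Q R \<alpha> x0 F =
     (\<Sum>i = 1..N. ennreal (\<alpha> i) * player_cost N n m A B C Q R i x0 F)"

(* With G_i the selector, each G_i F vanishes on the kernel of C_i. The condition is
   linear in F, so F and -F satisfy it simultaneously. *)
definition output_structured ::
  "nat \<Rightarrow> nat \<Rightarrow> (nat \<Rightarrow> nat) \<Rightarrow> (nat \<Rightarrow> rmat) \<Rightarrow> rmat \<Rightarrow> bool" where
  "output_structured N n m C F \<longleftrightarrow>
     (\<forall>i \<in> {1..N}. selector N m i * F *
        (1\<^sub>m n - transpose_mat (C i) * minv (C i * transpose_mat (C i)) * C i) = 0\<^sub>m (m i) n)"

(* Total cost relative to the optimal cooperative cost x0' P x0, which is positive
   when P is positive definite and x0 is nonzero. *)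
definition cost_ratio ::
  "nat \<Rightarrow> nat \<Rightarrow> (nat \<Rightarrow> nat) \<Rightarrow> rmat \<Rightarrow> (nat \<Rightarrow> rmat) \<Rightarrow> (nat \<Rightarrow> rmat) \<Rightarrow> (nat \<Rightarrow> rmat) \<Rightarrow>
   (nat \<Rightarrow> rmat) \<Rightarrow> rmat \<Rightarrow> rvec \<Rightarrow> rmat \<Rightarrow> ennreal" where
  "cost_ratio N n m A B C Q R P x0 F =
     (\<Sum>i = 1..N. player_cost N n m A B C Q R i x0 F) / ennreal (quad_form P x0)"

end

theory Submission
  imports Defs "Jordan_Normal_Form.Schur_Decomposition" "HOL-Real_Asymp.Real_Asymp"
begin

text \<open>Both ratios are at least 1 for one reason: no stabilizing feedback, structured or not, beats the
unconstrained optimum \<open>x0' P x0\<close>. Let \<open>x\<close> be the closed-loop trajectory of a gain \<open>F\<close> for which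
\<open>A + B F\<close> is Hurwitz and put \<open>u = F x\<close>. Inserting the Riccati equation into the derivative of the
storage function \<open>V = x' P x\<close> and completing the square, with \<open>R\<close> and \<open>Q\<close> the cooperative weights,
gives

\<open>V' + x' Q x + u' R u = (u + R\<inverse> B' P x)' R (u + R\<inverse> B' P x) \<ge> 0\<close>,

which is lemma \<open>are_dissipation_inequality\<close>. Integrating over \<open>[0, T]\<close>, the cost accumulated up to
time \<open>T\<close> is at least \<open>V(0) - V(T)\<close>, and \<open>V(T) \<rightarrow> 0\<close> because the closed loop is stable
(\<open>dissipation_lower_bound\<close>). The block structure of the selectors and of \<open>R\<close> makes
\<open>x' Q x + u' R u\<close> the sum of the running costs of the players, so their total cost is at least
\<open>x0' P x0\<close> (\<open>total_cost_ge_cooperative_cost\<close>). In the first claim the closed loop is Hurwitz by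
the definition of a stabilizing solution, in the second by hypothesis.

Stability is essential for the last limit: when the state weight vanishes and \<open>A\<close> is antistable,
\<open>P\<close> can be positive definite although \<open>u = 0\<close> costs nothing.

Two facts about \<open>x' = M x\<close> have to be established: a solution exists, so that the trajectory, a
choice among solutions, is one (\<open>linear_ode_solution_exists\<close>), and every solution tends to zero when
\<open>M\<close> is Hurwitz (\<open>hurwitz_ode_tendsto_zero\<close>).\<close>

section \<open>Quadratic forms\<close>

lemma mult_mat_vec_index_sum:
  assumes "M \<in> carrier_mat k n" "v \<in> carrier_vec n" "i < k"
  shows "(M *\<^sub>v v) $ i = (\<Sum>j<n. M $$ (i, j) * v $ j)"
  using assms by (auto simp: scalar_prod_def lessThan_atLeast0 intro!: sum.cong)

lemma quad_form_sum:
  assumes "M \<in> carrier_mat n n" "v \<in> carrier_vec n"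
  shows "quad_form M v = (\<Sum>i<n. v $ i * (\<Sum>j<n. M $$ (i, j) * v $ j))"
proof -
  have "quad_form M v = (\<Sum>i<n. v $ i * (M *\<^sub>v v) $ i)"
    using assms by (simp add: quad_form_def scalar_prod_def lessThan_atLeast0)
  also have "\<dots> = (\<Sum>i<n. v $ i * (\<Sum>j<n. M $$ (i, j) * v $ j))"
    by (intro sum.cong refl) (simp add: mult_mat_vec_index_sum[OF assms])
  finally show ?thesis .
qed

lemma scalar_prod_symmetric_mat:
  fixes M :: rmat
  assumes "M \<in> carrier_mat n n" "transpose_mat M = M" "v \<in> carrier_vec n" "w \<in> carrier_vec n"
  shows "v \<bullet> (M *\<^sub>v w) = w \<bullet> (M *\<^sub>v v)"
  using transpose_vec_mult_scalar[of M n n w v] assms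
  by (metis comm_scalar_prod mult_mat_vec_carrier)

lemma pos_def_quad_form_nonneg:
  assumes "pos_def k M" and "v \<in> carrier_vec k"
  shows "0 \<le> quad_form M v"
proof (cases "v = 0\<^sub>v k")
  case True
  then show ?thesis using assms by (auto simp: pos_def_def quad_form_def)
qed (use assms in \<open>auto simp: pos_def_def intro: less_imp_le\<close>)

lemma pos_def_minv:
  assumes "pos_def p M"
  shows "minv M \<in> carrier_mat p p" and "M * minv M = 1\<^sub>m p"
proof -
  have M: "M \<in> carrier_mat p p" using assms by (simp add: pos_def_def)
  have "det M \<noteq> 0"
  proof
    assume "det M = 0"
    then obtain v where v: "v \<in> carrier_vec p" "v \<noteq> 0\<^sub>v p" "M *\<^sub>v v = 0\<^sub>v p"
      using det_0_iff_vec_prod_zero_field[OF M] by blast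
    then have "quad_form M v = 0" by (simp add: quad_form_def)
    then show False using assms v by (force simp: pos_def_def)
  qed
  then have "M \<in> Units (ring_mat TYPE(real) p ())"
    using det_non_zero_imp_unit[OF M] by simp
  then obtain X where X: "mat_inverse M = Some X"
    using mat_inverse(1)[OF M] by fastforce
  then show "minv M \<in> carrier_mat p p" and "M * minv M = 1\<^sub>m p"
    using mat_inverse(2)[OF M X] by (auto simp: minv_def)
qed

lemma pos_def_smult:
  assumes "pos_def k M" and "0 < c"
  shows "pos_def k (c \<cdot>\<^sub>m M)"
proof -
  have M: "M \<in> carrier_mat k k" and sym: "transpose_mat M = M"
    using assms by (auto simp: pos_def_def)
  have "quad_form (c \<cdot>\<^sub>m M) v = c * quad_form M v" if "v \<in> carrier_vec k" for v
    using M that by (simp add: quad_form_sum[of _ k] sum_distrib_left mult_ac)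
  moreover have "transpose_mat (c \<cdot>\<^sub>m M) = c \<cdot>\<^sub>m M"
  proof -
    have "transpose_mat (c \<cdot>\<^sub>m M) = c \<cdot>\<^sub>m transpose_mat M"
      by (intro eq_matI) auto
    then show ?thesis by (simp add: sym)
  qed
  ultimately show ?thesis using assms M by (auto simp: pos_def_def)
qed

lemma quad_form_congruence:
  assumes "M \<in> carrier_mat k k" "L \<in> carrier_mat k n" "v \<in> carrier_vec n"
  shows "quad_form (transpose_mat L * M * L) v = quad_form M (L *\<^sub>v v)"
proof -
  have "quad_form (transpose_mat L * M * L) v = v \<bullet> (transpose_mat L *\<^sub>v (M *\<^sub>v (L *\<^sub>v v)))"
    using assms by (simp add: quad_form_def assoc_mult_mat_vec[of _ n k _ n] assoc_mult_mat_vec[of _ n k _ k])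
  also have "\<dots> = (transpose_mat L *\<^sub>v (M *\<^sub>v (L *\<^sub>v v))) \<bullet> v"
    using assms by (intro comm_scalar_prod[of _ n]) auto
  also have "\<dots> = (M *\<^sub>v (L *\<^sub>v v)) \<bullet> (L *\<^sub>v v)"
    using assms by (intro transpose_vec_mult_scalar) auto
  also have "\<dots> = (L *\<^sub>v v) \<bullet> (M *\<^sub>v (L *\<^sub>v v))"
    using assms by (intro comm_scalar_prod[of _ k]) auto
  finally show ?thesis by (simp add: quad_form_def)
qed

lemma quad_form_mat_sum:
  assumes M: "\<And>i. i \<in> I \<Longrightarrow> M i \<in> carrier_mat n n" and v: "v \<in> carrier_vec n"
  shows "quad_form (Matrix.mat n n (\<lambda>kl. \<Sum>i\<in>I. M i $$ kl)) v = (\<Sum>i\<in>I. quad_form (M i) v)"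
proof -
  have "quad_form (Matrix.mat n n (\<lambda>kl. \<Sum>i\<in>I. M i $$ kl)) v
      = (\<Sum>k<n. \<Sum>l<n. \<Sum>i\<in>I. v $ k * (M i $$ (k, l) * v $ l))"
    using v by (simp add: quad_form_sum[of _ n] sum_distrib_left sum_distrib_right)
  also have "\<dots> = (\<Sum>k<n. \<Sum>i\<in>I. \<Sum>l<n. v $ k * (M i $$ (k, l) * v $ l))"
    by (intro sum.cong refl sum.swap)
  also have "\<dots> = (\<Sum>i\<in>I. \<Sum>k<n. \<Sum>l<n. v $ k * (M i $$ (k, l) * v $ l))"
    by (rule sum.swap)
  also have "\<dots> = (\<Sum>i\<in>I. quad_form (M i) v)"
    using M v by (intro sum.cong refl) (simp add: quad_form_sum[of _ n] sum_distrib_left)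
  finally show ?thesis .
qed

section \<open>Solutions of linear differential equations\<close>

lemma iterate_mult_mat_vec_bound:
  fixes M :: rmat
  assumes M: "M \<in> carrier_mat n n" and v: "v \<in> carrier_vec n"
  obtains c K where "\<And>j k. k < n \<Longrightarrow> \<bar>((*\<^sub>v) M ^^ j) v $ k\<bar> \<le> K * c ^ j"
proof -
  define c where "c = (\<Sum>i<n. \<Sum>j<n. \<bar>M $$ (i, j)\<bar>)"
  define K where "K = (\<Sum>i<n. \<bar>v $ i\<bar>)"
  have carrier: "((*\<^sub>v) M ^^ j) v \<in> carrier_vec n" for j
    using M v by (induction j) auto
  have "\<bar>((*\<^sub>v) M ^^ j) v $ k\<bar> \<le> K * c ^ j" if "k < n" for j k
    using that
  proof (induction j arbitrary: k)
    case 0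
    then show ?case
      unfolding K_def by (auto intro: member_le_sum[of k "{..<n}" "\<lambda>i. \<bar>v $ i\<bar>"])
  next
    case (Suc j)
    have bound_nonneg: "0 \<le> K * c ^ j"
      unfolding K_def c_def by (intro mult_nonneg_nonneg zero_le_power sum_nonneg) auto
    have "\<bar>((*\<^sub>v) M ^^ Suc j) v $ k\<bar> = \<bar>\<Sum>l<n. M $$ (k, l) * ((*\<^sub>v) M ^^ j) v $ l\<bar>"
      using mult_mat_vec_index_sum[OF M carrier Suc.prems] by simp
    also have "\<dots> \<le> (\<Sum>l<n. \<bar>M $$ (k, l)\<bar> * (K * c ^ j))"
      by (rule order_trans[OF sum_abs])
        (intro sum_mono, simp add: abs_mult Suc.IH mult_left_mono)
    also have "\<dots> = (\<Sum>l<n. \<bar>M $$ (k, l)\<bar>) * (K * c ^ j)"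
      by (simp add: sum_distrib_right)
    also have "\<dots> \<le> c * (K * c ^ j)"
      unfolding c_def using Suc.prems bound_nonneg
      by (intro mult_right_mono member_le_sum[of k "{..<n}" "\<lambda>i. \<Sum>j<n. \<bar>M $$ (i, j)\<bar>"])
        (auto simp: c_def intro: sum_nonneg)
    finally show ?case by (simp add: algebra_simps)
  qed
  then show ?thesis by (rule that)
qed

text \<open>The solution is the matrix exponential \<open>e\<^bsup>tM\<^esup> v\<close>, written coordinatewise as a power series in \<open>t\<close>
with coefficients \<open>(M\<^bsup>j\<^esup> v)\<^sub>k / j!\<close>; these converge everywhere because the iterates \<open>M\<^bsup>j\<^esup> v\<close> grow at
most geometrically, and differentiating term by term shifts \<open>j\<close>, which is multiplication by \<open>M\<close>.\<close>

lemma linear_ode_solution_exists: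
  assumes M: "M \<in> carrier_mat n n" and v: "v \<in> carrier_vec n"
  shows "\<exists>x. linear_ode_solution n M v x"
proof -
  define w where "w j = ((*\<^sub>v) M ^^ j) v" for j
  define a where "a k j = w j $ k / fact j" for k j
  define x where "x t = Matrix.vec n (\<lambda>k. \<Sum>j. a k j * t ^ j)" for t :: real
  have w_carrier: "w j \<in> carrier_vec n" for j
    unfolding w_def using M v by (induction j) auto
  obtain c K where bound: "\<And>j k. k < n \<Longrightarrow> \<bar>w j $ k\<bar> \<le> K * c ^ j"
    using iterate_mult_mat_vec_bound[OF M v] unfolding w_def by blast
  have summable: "summable (\<lambda>j. a k j * t ^ j)" if k: "k < n" for k t
  proof (rule summable_comparison_test')
    show "summable (\<lambda>j. K * (inverse (fact j) * (c * \<bar>t\<bar>) ^ j))"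
      by (intro summable_mult summable_exp)
    fix j :: nat
    have "\<bar>w j $ k\<bar> * \<bar>t\<bar> ^ j / fact j \<le> K * c ^ j * \<bar>t\<bar> ^ j / fact j"
      by (intro divide_right_mono mult_right_mono bound k) auto
    then show "norm (a k j * t ^ j) \<le> K * (inverse (fact j) * (c * \<bar>t\<bar>) ^ j)"
      unfolding a_def by (simp add: abs_mult power_abs power_mult_distrib divide_inverse mult_ac)
  qed
  have deriv: "((\<lambda>t. x t $ k) has_real_derivative (M *\<^sub>v x t) $ k) (at t)" if k: "k < n" for k t
  proof -
    have diffs: "diffs (a k) j = (\<Sum>l<n. M $$ (k, l) * a l j)" for j
    proof -
      have "diffs (a k) j = w (Suc j) $ k / fact j"
        unfolding diffs_def a_def by (simp add: divide_simps)
      also have "\<dots> = (\<Sum>l<n. M $$ (k, l) * w j $ l) / fact j"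
        using mult_mat_vec_index_sum[OF M w_carrier k] by (simp add: w_def)
      finally show ?thesis by (simp add: a_def sum_divide_distrib)
    qed
    have "((\<lambda>t. \<Sum>j. a k j * t ^ j) has_real_derivative (\<Sum>j. diffs (a k) j * t ^ j)) (at t)"
      by (rule termdiffs_strong_converges_everywhere) (rule summable[OF k])
    also have "(\<Sum>j. diffs (a k) j * t ^ j) = (\<Sum>j. \<Sum>l<n. M $$ (k, l) * (a l j * t ^ j))"
      by (simp add: diffs sum_distrib_right mult.assoc)
    also have "\<dots> = (\<Sum>l<n. M $$ (k, l) * (\<Sum>j. a l j * t ^ j))"
      by (subst suminf_sum) (auto intro!: summable_mult summable sum.cong suminf_mult)
    also have "\<dots> = (M *\<^sub>v x t) $ k"
      using mult_mat_vec_index_sum[OF M _ k, of "x t"] by (simp add: x_def)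
    finally show ?thesis using k by (simp add: x_def)
  qed
  have "x 0 = v"
    using v by (intro eq_vecI) (auto simp: x_def powser_zero a_def w_def simp del: times_divide_eq_left)
  then have "linear_ode_solution n M v x"
    unfolding linear_ode_solution_def using deriv
    by (auto simp: x_def intro: has_field_derivative_at_within)
  then show ?thesis by blast
qed

lemma trajectory_solves:
  assumes "M \<in> carrier_mat n n" and "v \<in> carrier_vec n"
  shows "linear_ode_solution n M v (trajectory n M v)"
  unfolding trajectory_def using linear_ode_solution_exists[OF assms] by (rule someI_ex)

section \<open>Decay under a Hurwitz matrix\<close>

text \<open>A stable scalar equation forgets a vanishing input. With \<open>a = - Re \<mu>\<close>, the squared modulus \<open>w\<close> of
\<open>y\<close> obeys \<open>w' \<le> - a w + \<bar>g\<bar>\<^sup>2 / a\<close>: half of the available decay \<open>2 a w\<close> absorbs the cross term.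
Once \<open>\<bar>g\<bar>\<^sup>2 / a < a e\<close>, the function \<open>e\<^bsup>at\<^esup> (w - e)\<close> is nonincreasing, so \<open>w\<close> ends up below
any bound larger than \<open>e\<close>.\<close>

lemma scalar_ode_tendsto_zero:
  fixes y g :: "real \<Rightarrow> complex"
  assumes deriv: "\<And>t. 0 \<le> t \<Longrightarrow> (y has_vector_derivative \<mu> * y t + g t) (at t within {0..})"
    and \<mu>: "Re \<mu> < 0"
    and g: "(g \<longlongrightarrow> 0) at_top"
  shows "(y \<longlongrightarrow> 0) at_top"
proof -
  define a where "a = - Re \<mu>"
  have a: "a > 0" using \<mu> by (simp add: a_def)
  define w where "w t = (norm (y t))\<^sup>2" for t
  define w' where "w' t = 2 * Re (cnj (y t) * (\<mu> * y t + g t))" for t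
  have w_deriv: "(w has_real_derivative w' t) (at t within {0..})" if t: "0 \<le> t" for t
  proof -
    have "((\<lambda>t. Re (y t)) has_real_derivative Re (\<mu> * y t + g t)) (at t within {0..})"
      using bounded_linear.has_vector_derivative[OF bounded_linear_Re deriv[OF t]]
      by (simp add: has_real_derivative_iff_has_vector_derivative)
    moreover have "((\<lambda>t. Im (y t)) has_real_derivative Im (\<mu> * y t + g t)) (at t within {0..})"
      using bounded_linear.has_vector_derivative[OF bounded_linear_Im deriv[OF t]]
      by (simp add: has_real_derivative_iff_has_vector_derivative)
    ultimately have "((\<lambda>t. (Re (y t))\<^sup>2 + (Im (y t))\<^sup>2) has_real_derivative
        2 * Re (y t) * Re (\<mu> * y t + g t) + 2 * Im (y t) * Im (\<mu> * y t + g t)) (at t within {0..})"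
      by (rule DERIV_cong[OF DERIV_add[OF DERIV_power[where n = 2] DERIV_power[where n = 2]]]) simp
    then show ?thesis
      unfolding w_def w'_def cmod_power2 by (simp add: algebra_simps)
  qed
  have w'_le: "w' t \<le> - a * w t + (norm (g t))\<^sup>2 / a" for t
  proof -
    have "cnj (y t) * y t = of_real (w t)"
      unfolding w_def by (metis complex_norm_square mult.commute)
    then have "Re (cnj (y t) * (\<mu> * y t)) = - a * w t"
      by (simp add: a_def mult.left_commute[of _ \<mu>] del: complex_cnj_mult)
    then have "w' t = - 2 * a * w t + 2 * Re (cnj (y t) * g t)"
      by (simp add: w'_def distrib_left)
    moreover have "Re (cnj (y t) * g t) \<le> norm (y t) * norm (g t)"
      by (metis complex_Re_le_cmod complex_mod_cnj norm_mult)
    moreover have "2 * (norm (y t) * norm (g t)) \<le> a * w t + (norm (g t))\<^sup>2 / a"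
    proof -
      have "0 \<le> (a * norm (y t) - norm (g t))\<^sup>2 / a" using a by simp
      also have "\<dots> = a * w t + (norm (g t))\<^sup>2 / a - 2 * (norm (y t) * norm (g t))"
        using a by (simp add: w_def field_simps power2_eq_square)
      finally show ?thesis by simp
    qed
    ultimately show ?thesis by linarith
  qed
  have "(w \<longlongrightarrow> 0) at_top"
  proof (rule tendstoI)
    fix \<epsilon> :: real assume \<epsilon>: "\<epsilon> > 0"
    define e where "e = \<epsilon> / 2"
    have e: "e > 0" "e < \<epsilon>" using \<epsilon> by (auto simp: e_def)
    have "((\<lambda>t. (norm (g t))\<^sup>2 / a) \<longlongrightarrow> 0\<^sup>2 / a) at_top"
      using a by (intro tendsto_intros tendsto_norm_zero g) auto
    then have "\<forall>\<^sub>F t in at_top. (norm (g t))\<^sup>2 / a < a * e"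
      using a e by (intro order_tendstoD(2)) auto
    then obtain T0 where T0: "\<And>t. t \<ge> T0 \<Longrightarrow> (norm (g t))\<^sup>2 / a < a * e"
      by (auto simp: eventually_at_top_linorder)
    define T where "T = max T0 0"
    define h where "h t = exp (a * t) * (w t - e)" for t
    have h_deriv: "(h has_real_derivative exp (a * t) * (a * (w t - e) + w' t)) (at t within {0..})"
      if "0 \<le> t" for t
      unfolding h_def
      by (rule derivative_eq_intros w_deriv[OF that] refl | simp add: algebra_simps)+
    have h_le: "h t \<le> h T" if t: "T \<le> t" for t
      using t
    proof (rule DERIV_nonpos_imp_decreasing_open)
      fix s assume s: "T < s" "s < t"
      then have s': "s > 0" "s \<ge> T0" by (auto simp: T_def)
      then have "at s within {0..} = at s"
        by (intro at_within_interior) simp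
      then have "(h has_real_derivative exp (a * s) * (a * (w s - e) + w' s)) (at s)"
        using h_deriv[of s] s' by simp
      moreover have "a * (w s - e) + w' s \<le> 0"
        using w'_le[of s] T0[OF s'(2)] by (simp add: algebra_simps)
      ultimately show "\<exists>d. (h has_real_derivative d) (at s) \<and> d \<le> 0"
        by (blast intro: mult_nonneg_nonpos exp_ge_zero)
    next
      have "continuous_on {0..} h"
        by (rule DERIV_continuous_on) (rule h_deriv, simp)
      then show "continuous_on {T..t} h"
        by (rule continuous_on_subset) (auto simp: T_def)
    qed
    have w_le: "w t \<le> e + exp (- (a * t)) * h T" if t: "T \<le> t" for t
    proof -
      have "exp (- (a * t)) * h t \<le> exp (- (a * t)) * h T"
        using h_le[OF t] by simp
      moreover have "exp (- (a * t)) * h t = w t - e"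
        by (simp add: h_def mult.assoc[symmetric] exp_add[symmetric])
      ultimately show ?thesis by simp
    qed
    have "((\<lambda>t. e + exp (- (a * t)) * h T) \<longlongrightarrow> e) at_top"
      using a by real_asymp
    then have "\<forall>\<^sub>F t in at_top. e + exp (- (a * t)) * h T < \<epsilon>"
      using e by (intro order_tendstoD(2))
    then show "\<forall>\<^sub>F t in at_top. dist (w t) 0 < \<epsilon>"
      using eventually_ge_at_top[of T]
    proof eventually_elim
      case (elim t)
      moreover have "0 \<le> w t" by (simp add: w_def)
      ultimately show ?case using w_le[of t] by simp
    qed
  qed
  then have "((\<lambda>t. sqrt (w t)) \<longlongrightarrow> sqrt 0) at_top"
    by (rule tendsto_real_sqrt)
  then show ?thesis
    by (simp add: w_def tendsto_norm_zero_iff)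
qed

text \<open>In Schur coordinates \<open>y = W x\<close> the system is upper triangular, with eigenvalues of \<open>M\<close> on the
diagonal. The last coordinate solves a homogeneous stable scalar equation, and each earlier one is
driven only by later coordinates, which tend to zero already.\<close>

lemma hurwitz_ode_tendsto_zero:
  assumes M: "M \<in> carrier_mat n n" and hurwitz: "hurwitz M"
    and sol: "linear_ode_solution n M v x" and k: "k < n"
  shows "((\<lambda>t. x t $ k) \<longlongrightarrow> 0) at_top"
proof -
  let ?Mc = "map_mat complex_of_real M"
  let ?xc = "\<lambda>t. map_vec complex_of_real (x t)"
  have Mc: "?Mc \<in> carrier_mat n n" using M by simp
  obtain es where es: "char_poly ?Mc = (\<Prod>e\<leftarrow>es. [:- e, 1:])"
    using char_poly_factorized[OF Mc] by blast
  obtain T U W where "schur_decomposition ?Mc es = (T, U, W)"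
    by (metis prod_cases3)
  from schur_decomposition[OF Mc es this]
  have wit: "similar_mat_wit ?Mc T U W" and triangular: "upper_triangular T"
    and diag: "diag_mat T = es" by auto
  note sim = similar_mat_witD2[OF Mc wit]
  have T: "T \<in> carrier_mat n n" and U: "U \<in> carrier_mat n n" and W: "W \<in> carrier_mat n n"
    using sim by auto
  have diag_neg: "Re (T $$ (i, i)) < 0" if "i < n" for i
  proof -
    have "T $$ (i, i) \<in> set es"
      using that T by (auto simp: diag[symmetric] diag_mat_def)
    then have "poly (char_poly ?Mc) (T $$ (i, i)) = 0"
      unfolding es by (force simp: poly_prod_list prod_list_zero_iff)
    then have "eigenvalue ?Mc (T $$ (i, i))"
      by (simp add: eigenvalue_root_char_poly[OF Mc])
    then show ?thesis using hurwitz by (simp add: hurwitz_def)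
  qed
  have x: "x t \<in> carrier_vec n" if "0 \<le> t" for t
    using sol that by (simp add: linear_ode_solution_def)
  have x_deriv: "((\<lambda>\<tau>. x \<tau> $ j) has_real_derivative (M *\<^sub>v x t) $ j) (at t within {0..})"
    if "0 \<le> t" "j < n" for t j
    using sol that by (simp add: linear_ode_solution_def)
  \<comment> \<open>The sum is used instead of \<open>W *\<^sub>v x t\<close> since \<open>x t\<close> has dimension \<open>n\<close> only for \<open>t \<ge> 0\<close>.\<close>
  define y where "y i t = (\<Sum>j<n. W $$ (i, j) * complex_of_real (x t $ j))" for i t
  have y_eq: "y i t = (W *\<^sub>v ?xc t) $ i" if "0 \<le> t" "i < n" for i t
    using mult_mat_vec_index_sum[OF W _ that(2), of "?xc t"] x[OF that(1)] by (simp add: y_def)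
  have y_deriv: "(y i has_vector_derivative
      T $$ (i, i) * y i t + (\<Sum>j\<in>{i<..<n}. T $$ (i, j) * y j t)) (at t within {0..})"
    if t: "0 \<le> t" and i: "i < n" for i t
  proof -
    have xc: "?xc t \<in> carrier_vec n" using x[OF t] by simp
    have "(y i has_vector_derivative
        (\<Sum>j<n. W $$ (i, j) * complex_of_real ((M *\<^sub>v x t) $ j))) (at t within {0..})"
      unfolding y_def
      by (intro has_vector_derivative_sum has_vector_derivative_mult_right
          has_vector_derivative_of_real)
        (use x_deriv[OF t] in \<open>auto simp: has_real_derivative_iff_has_vector_derivative\<close>)
    also have "(\<Sum>j<n. W $$ (i, j) * complex_of_real ((M *\<^sub>v x t) $ j)) = (W *\<^sub>v (?Mc *\<^sub>v ?xc t)) $ i"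
    proof -
      have "?Mc *\<^sub>v ?xc t = map_vec complex_of_real (M *\<^sub>v x t)"
        by (rule of_real_hom.mult_mat_vec_hom[OF M x[OF t], symmetric])
      then show ?thesis
        using mult_mat_vec_index_sum[OF W _ i, of "map_vec complex_of_real (M *\<^sub>v x t)"]
          mult_mat_vec_carrier[OF M x[OF t]] M
        by (simp del: index_mult_mat_vec)
    qed
    also have "W *\<^sub>v (?Mc *\<^sub>v ?xc t) = T *\<^sub>v (W *\<^sub>v ?xc t)"
    proof -
      have "W * ?Mc = W * (U * (T * W))"
        using sim(3) T U W by (metis assoc_mult_mat)
      also have "\<dots> = (W * U) * (T * W)"
        using T U W by (metis assoc_mult_mat mult_carrier_mat)
      also have "\<dots> = T * W" using sim(2) T W by (metis left_mult_one_mat mult_carrier_mat)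
      finally show ?thesis
        using T W Mc xc by (metis assoc_mult_mat_vec)
    qed
    also have "(T *\<^sub>v (W *\<^sub>v ?xc t)) $ i = (\<Sum>j<n. T $$ (i, j) * y j t)"
      using mult_mat_vec_index_sum[OF T _ i, of "W *\<^sub>v ?xc t"] W xc y_eq[OF t]
      by (simp del: index_mult_mat_vec)
    also have "\<dots> = (\<Sum>j\<in>insert i {i<..<n}. T $$ (i, j) * y j t)"
      using triangular T i by (intro sum.mono_neutral_right) (auto simp: not_less)
    finally show ?thesis by simp
  qed
  have y_tendsto: "(y i \<longlongrightarrow> 0) at_top" if "i < n" for i
    using that
  proof (induction "n - i" arbitrary: i rule: less_induct)
    case less
    have "((\<lambda>t. \<Sum>j\<in>{i<..<n}. T $$ (i, j) * y j t) \<longlongrightarrow> (\<Sum>j\<in>{i<..<n}. T $$ (i, j) * 0)) at_top"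
      using less by (intro tendsto_sum tendsto_mult_left less.hyps) auto
    then have "((\<lambda>t. \<Sum>j\<in>{i<..<n}. T $$ (i, j) * y j t) \<longlongrightarrow> 0) at_top" by simp
    with y_deriv diag_neg less.prems show ?case
      by (intro scalar_ode_tendsto_zero[of "y i" "T $$ (i, i)"]) auto
  qed
  have "((\<lambda>t. \<Sum>i<n. U $$ (k, i) * y i t) \<longlongrightarrow> (\<Sum>i<n. U $$ (k, i) * 0)) at_top"
    by (intro tendsto_sum tendsto_mult_left y_tendsto) auto
  moreover have "\<forall>\<^sub>F t in at_top. (\<Sum>i<n. U $$ (k, i) * y i t) = complex_of_real (x t $ k)"
    using eventually_ge_at_top[of 0]
  proof eventually_elim
    case (elim t)
    have xc: "?xc t \<in> carrier_vec n" using x[OF elim] by simp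
    have "U *\<^sub>v (W *\<^sub>v ?xc t) = ?xc t"
      using U W xc sim(1) by (metis assoc_mult_mat_vec one_mult_mat_vec)
    moreover have "(U *\<^sub>v (W *\<^sub>v ?xc t)) $ k = (\<Sum>i<n. U $$ (k, i) * y i t)"
      using mult_mat_vec_index_sum[OF U _ k, of "W *\<^sub>v ?xc t"] W xc y_eq[OF elim]
      by (simp del: index_mult_mat_vec)
    ultimately show ?case using x[OF elim] k by simp
  qed
  ultimately have "((\<lambda>t. complex_of_real (x t $ k)) \<longlongrightarrow> complex_of_real 0) at_top"
    by (simp add: filterlim_cong)
  then show ?thesis by (simp only: tendsto_of_real_iff)
qed

section \<open>Quadratic forms along trajectories\<close>

lemma continuous_on_quad_form:
  assumes M: "M \<in> carrier_mat k k" and L: "L \<in> carrier_mat k n"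
    and x: "\<And>t. t \<in> S \<Longrightarrow> x t \<in> carrier_vec n"
    and cont: "\<And>j. j < n \<Longrightarrow> continuous_on S (\<lambda>t. x t $ j)"
  shows "continuous_on S (\<lambda>t. quad_form M (L *\<^sub>v x t))"
proof -
  have "continuous_on S (\<lambda>t. \<Sum>i<k. (\<Sum>j<n. L $$ (i, j) * x t $ j) *
      (\<Sum>l<k. M $$ (i, l) * (\<Sum>j<n. L $$ (l, j) * x t $ j)))"
    by (intro continuous_intros cont) auto
  moreover have "quad_form M (L *\<^sub>v x t) = (\<Sum>i<k. (\<Sum>j<n. L $$ (i, j) * x t $ j) *
      (\<Sum>l<k. M $$ (i, l) * (\<Sum>j<n. L $$ (l, j) * x t $ j)))" if "t \<in> S" for t
    using quad_form_sum[OF M mult_mat_vec_carrier[OF L x[OF that]]]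
    by (simp add: mult_mat_vec_index_sum[OF L x[OF that]] del: index_mult_mat_vec)
  ultimately show ?thesis by (simp cong: continuous_on_cong)
qed

lemma quad_form_derivative:
  assumes P: "P \<in> carrier_mat n n" "transpose_mat P = P" and M: "M \<in> carrier_mat n n"
    and sol: "linear_ode_solution n M v x" and t: "0 \<le> t"
  shows "((\<lambda>t. quad_form P (x t)) has_real_derivative 2 * (x t \<bullet> (P *\<^sub>v (M *\<^sub>v x t)))) (at t within {0..})"
proof -
  have x: "x t \<in> carrier_vec n" if "0 \<le> t" for t
    using sol that by (simp add: linear_ode_solution_def)
  let ?y = "M *\<^sub>v x t"
  have y: "?y \<in> carrier_vec n" using M x[OF t] by simp
  have deriv: "((\<lambda>\<tau>. x \<tau> $ j) has_real_derivative ?y $ j) (at t within {0..})" if "j < n" for j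
    using sol that t by (simp add: linear_ode_solution_def)
  have Py: "w \<bullet> (P *\<^sub>v z) = (\<Sum>i<n. w $ i * (\<Sum>j<n. P $$ (i, j) * z $ j))"
    if "z \<in> carrier_vec n" for w z
    using P(1) mult_mat_vec_index_sum[OF P(1) that]
    by (auto simp: scalar_prod_def[of w] lessThan_atLeast0 simp del: index_mult_mat_vec intro!: sum.cong)
  have "((\<lambda>\<tau>. \<Sum>i<n. x \<tau> $ i * (\<Sum>j<n. P $$ (i, j) * x \<tau> $ j)) has_real_derivative
      (\<Sum>i<n. x t $ i * (\<Sum>j<n. P $$ (i, j) * ?y $ j) + ?y $ i * (\<Sum>j<n. P $$ (i, j) * x t $ j)))
      (at t within {0..})"
    by (intro DERIV_sum DERIV_mult' DERIV_cmult deriv) auto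
  also have "(\<Sum>i<n. x t $ i * (\<Sum>j<n. P $$ (i, j) * ?y $ j) + ?y $ i * (\<Sum>j<n. P $$ (i, j) * x t $ j))
      = x t \<bullet> (P *\<^sub>v ?y) + ?y \<bullet> (P *\<^sub>v x t)"
    unfolding Py[OF y] Py[OF x[OF t]] by (rule sum.distrib)
  also have "?y \<bullet> (P *\<^sub>v x t) = x t \<bullet> (P *\<^sub>v ?y)"
    by (rule scalar_prod_symmetric_mat[OF P y x[OF t]])
  finally have "((\<lambda>\<tau>. \<Sum>i<n. x \<tau> $ i * (\<Sum>j<n. P $$ (i, j) * x \<tau> $ j)) has_real_derivative
      2 * (x t \<bullet> (P *\<^sub>v ?y))) (at t within {0..})"
    by simp
  then show ?thesis
    by (rule has_field_derivative_transform_within[where d = 1])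
      (use t x quad_form_sum[OF P(1)] in auto)
qed

lemma quad_form_tendsto_zero:
  fixes x :: "real \<Rightarrow> rvec"
  assumes P: "P \<in> carrier_mat n n" and x: "\<And>t. 0 \<le> t \<Longrightarrow> x t \<in> carrier_vec n"
    and lim: "\<And>k. k < n \<Longrightarrow> ((\<lambda>t. x t $ k) \<longlongrightarrow> 0) at_top"
  shows "((\<lambda>t. quad_form P (x t)) \<longlongrightarrow> 0) at_top"
proof -
  have "((\<lambda>t. \<Sum>i<n. x t $ i * (\<Sum>j<n. P $$ (i, j) * x t $ j)) \<longlongrightarrow>
      (\<Sum>i<n. 0 * (\<Sum>j<n. P $$ (i, j) * 0))) at_top"
    by (intro tendsto_intros lim) auto
  moreover have "\<forall>\<^sub>F t in at_top. (\<Sum>i<n. x t $ i * (\<Sum>j<n. P $$ (i, j) * x t $ j)) = quad_form P (x t)"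
    by (rule eventually_mono[OF eventually_ge_at_top[of "0::real"]]) (simp add: quad_form_sum[OF P x])
  ultimately show ?thesis by (simp add: filterlim_cong)
qed

section \<open>Dissipation of the storage function\<close>

text \<open>Completing the square: with \<open>w = B' P x\<close> and \<open>h = R\<inverse> w\<close>, the Riccati equation says
\<open>2 x' P A x + x' Q x = w' h\<close>, so that the right-hand side below is \<open>(u + h)' R (u + h)\<close>, which
vanishes for the optimal feedback \<open>u = - h\<close>.\<close>

lemma are_dissipation_inequality:
  assumes A: "A \<in> carrier_mat n n" and B: "B \<in> carrier_mat n p"
    and Q: "Q \<in> carrier_mat n n" and R: "pos_def p R" and P: "pos_def n P"
    and are: "transpose_mat A * P + P * A + Q - P * B * minv R * transpose_mat B * P = 0\<^sub>m n n"
    and x: "x \<in> carrier_vec n" and u: "u \<in> carrier_vec p"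
  shows "0 \<le> 2 * (x \<bullet> (P *\<^sub>v (A *\<^sub>v x + B *\<^sub>v u))) + (quad_form Q x + quad_form R u)"
proof -
  note S = pos_def_minv[OF R]
  have Pc: "P \<in> carrier_mat n n" and Psym: "transpose_mat P = P"
    using P by (auto simp: pos_def_def)
  have Rc: "R \<in> carrier_mat p p" and Rsym: "transpose_mat R = R"
    using R by (auto simp: pos_def_def)
  define w where "w = transpose_mat B *\<^sub>v (P *\<^sub>v x)"
  define h where "h = minv R *\<^sub>v w"
  have Px: "P *\<^sub>v x \<in> carrier_vec n" using Pc x by simp
  have w: "w \<in> carrier_vec p" using B Px by (simp add: w_def)
  have h: "h \<in> carrier_vec p" using S w by (simp add: h_def)
  have Rh: "R *\<^sub>v h = w"
    unfolding h_def using S Rc w by (metis assoc_mult_mat_vec one_mult_mat_vec)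
  have PB: "x \<bullet> (P *\<^sub>v (B *\<^sub>v z)) = w \<bullet> z" if z: "z \<in> carrier_vec p" for z
  proof -
    have "x \<bullet> (P *\<^sub>v (B *\<^sub>v z)) = (B *\<^sub>v z) \<bullet> (P *\<^sub>v x)"
      using scalar_prod_symmetric_mat[OF Pc Psym x] B z by simp
    also have "\<dots> = (P *\<^sub>v x) \<bullet> (B *\<^sub>v z)"
      using B z Px by (intro comm_scalar_prod) auto
    also have "\<dots> = w \<bullet> z"
      unfolding w_def using transpose_vec_mult_scalar[OF B z Px] by simp
    finally show ?thesis .
  qed
  have "x \<bullet> ((transpose_mat A * P + P * A + Q - P * B * minv R * transpose_mat B * P) *\<^sub>v x) = 0"
  proof -
    have "0\<^sub>m n n *\<^sub>v x = 0\<^sub>v n" using x by (intro eq_vecI) auto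
    then show ?thesis unfolding are using x by simp
  qed
  moreover have "(transpose_mat A * P + P * A + Q - P * B * minv R * transpose_mat B * P) *\<^sub>v x
     = transpose_mat A *\<^sub>v (P *\<^sub>v x) + P *\<^sub>v (A *\<^sub>v x) + Q *\<^sub>v x - P *\<^sub>v (B *\<^sub>v h)"
  proof -
    have PB_carrier: "P * B \<in> carrier_mat n p" using Pc B by simp
    have PBS_carrier: "P * B * minv R \<in> carrier_mat n p" using PB_carrier S by simp
    have PBSB_carrier: "P * B * minv R * transpose_mat B \<in> carrier_mat n n"
      using PBS_carrier B by simp
    have "P * B * minv R * transpose_mat B * P *\<^sub>v x = P * B * minv R *\<^sub>v w"
      unfolding w_def using assoc_mult_mat_vec[OF PBSB_carrier Pc x]
        assoc_mult_mat_vec[OF PBS_carrier _ Px] B by simp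
    also have "\<dots> = P *\<^sub>v (B *\<^sub>v h)"
      unfolding h_def using assoc_mult_mat_vec[OF PB_carrier _ w] assoc_mult_mat_vec[OF Pc B] S w
      by simp
    finally have "P * B * minv R * transpose_mat B * P *\<^sub>v x = P *\<^sub>v (B *\<^sub>v h)" .
    moreover have "P * B * minv R * transpose_mat B * P \<in> carrier_mat n n"
      using PBSB_carrier Pc by simp
    ultimately show ?thesis
      using A B Q Pc S x
      by (simp add: minus_mult_distrib_mat_vec[of _ n n] add_mult_distrib_mat_vec[of _ n n]
        assoc_mult_mat_vec[of _ n n _ n])
  qed
  moreover have "x \<bullet> (transpose_mat A *\<^sub>v (P *\<^sub>v x) + P *\<^sub>v (A *\<^sub>v x) + Q *\<^sub>v x - P *\<^sub>v (B *\<^sub>v h))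
     = x \<bullet> (transpose_mat A *\<^sub>v (P *\<^sub>v x)) + x \<bullet> (P *\<^sub>v (A *\<^sub>v x)) + x \<bullet> (Q *\<^sub>v x) - x \<bullet> (P *\<^sub>v (B *\<^sub>v h))"
    using A B Q Pc S x h
    by (simp add: scalar_prod_minus_distrib[of _ n] scalar_prod_add_distrib[of _ n])
  moreover have "x \<bullet> (transpose_mat A *\<^sub>v (P *\<^sub>v x)) = x \<bullet> (P *\<^sub>v (A *\<^sub>v x))"
  proof -
    have "x \<bullet> (transpose_mat A *\<^sub>v (P *\<^sub>v x)) = (transpose_mat A *\<^sub>v (P *\<^sub>v x)) \<bullet> x"
      using A Px x by (intro comm_scalar_prod[of _ n]) auto
    also have "\<dots> = (P *\<^sub>v x) \<bullet> (A *\<^sub>v x)"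
      using transpose_vec_mult_scalar[OF A x Px] .
    also have "\<dots> = (A *\<^sub>v x) \<bullet> (P *\<^sub>v x)"
      using A Px x by (intro comm_scalar_prod[of _ n]) auto
    also have "\<dots> = x \<bullet> (P *\<^sub>v (A *\<^sub>v x))"
      using scalar_prod_symmetric_mat[OF Pc Psym] A x by simp
    finally show ?thesis .
  qed
  ultimately have riccati: "2 * (x \<bullet> (P *\<^sub>v (A *\<^sub>v x))) + quad_form Q x = w \<bullet> h"
    using PB[OF h] by (simp add: quad_form_def)
  have "quad_form R (u + h) = quad_form R u + 2 * (w \<bullet> u) + w \<bullet> h"
  proof -
    have "quad_form R (u + h) = (u + h) \<bullet> (R *\<^sub>v u + w)"
      unfolding quad_form_def using mult_add_distrib_mat_vec[OF Rc u h] by (simp add: Rh)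
    also have "\<dots> = u \<bullet> (R *\<^sub>v u) + u \<bullet> w + (h \<bullet> (R *\<^sub>v u) + h \<bullet> w)"
      using u h w Rc
      by (simp add: add_scalar_prod_distrib[of _ p] scalar_prod_add_distrib[of _ p])
    also have "h \<bullet> (R *\<^sub>v u) = u \<bullet> w"
      using scalar_prod_symmetric_mat[OF Rc Rsym h u] by (simp add: Rh)
    also have "u \<bullet> w = w \<bullet> u" using u w by (rule comm_scalar_prod)
    also have "h \<bullet> w = w \<bullet> h" using h w by (rule comm_scalar_prod)
    finally show ?thesis by (simp add: quad_form_def)
  qed
  moreover have "0 \<le> quad_form R (u + h)"
    using R u h by (intro pos_def_quad_form_nonneg) auto
  moreover have "x \<bullet> (P *\<^sub>v (A *\<^sub>v x + B *\<^sub>v u)) = x \<bullet> (P *\<^sub>v (A *\<^sub>v x)) + w \<bullet> u"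
  proof -
    have "P *\<^sub>v (A *\<^sub>v x + B *\<^sub>v u) = P *\<^sub>v (A *\<^sub>v x) + P *\<^sub>v (B *\<^sub>v u)"
      using A B Pc x u by (intro mult_add_distrib_mat_vec[of _ n n]) auto
    then show ?thesis
      using scalar_prod_add_distrib[of x n "P *\<^sub>v (A *\<^sub>v x)" "P *\<^sub>v (B *\<^sub>v u)"] A B Pc x u PB[OF u]
      by simp
  qed
  ultimately show ?thesis using riccati by simp
qed

text \<open>The derivative of \<open>V\<close> is bounded below by \<open>- f\<close>, so \<open>V\<close> can reach its limit zero only if the
total \<open>f\<close> spent is at least \<open>V 0\<close>. The integral may be infinite.\<close>

lemma dissipation_lower_bound:
  fixes V V' f :: "real \<Rightarrow> real"
  assumes deriv: "\<And>t. 0 \<le> t \<Longrightarrow> (V has_real_derivative V' t) (at t within {0..})"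
    and cont: "continuous_on {0..} f" and nonneg: "\<And>t. 0 \<le> t \<Longrightarrow> 0 \<le> f t"
    and dissipation: "\<And>t. 0 \<le> t \<Longrightarrow> 0 \<le> V' t + f t"
    and V: "(V \<longlongrightarrow> 0) at_top"
  shows "ennreal (V 0) \<le> (\<integral>\<^sup>+t\<in>{0..}. ennreal (f t) \<partial>lborel)" (is "_ \<le> ?J")
proof -
  have bound: "ennreal (V 0 - V T) \<le> ?J" if T: "0 \<le> T" for T
  proof -
    have "(V' has_integral V T - V 0) {0..T}"
      using T
    proof (rule fundamental_theorem_of_calculus)
      fix t assume "t \<in> {0..T}"
      then show "(V has_vector_derivative V' t) (at t within {0..T})"
        using has_vector_derivative_within_subset[of V "V' t" t "{0..}" "{0..T}"] deriv[of t]
        by (auto simp: has_real_derivative_iff_has_vector_derivative)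
    qed
    then have V'_int: "((\<lambda>t. - V' t) has_integral V 0 - V T) {0..T}"
      using has_integral_neg[of V' "V T - V 0" "{0..T}"] by simp
    have "f integrable_on {0..T}"
      by (intro integrable_continuous_interval continuous_on_subset[OF cont]) auto
    then have f_int: "(f has_integral integral {0..T} f) {0..T}"
      by (rule integrable_integral)
    have "V 0 - V T \<le> integral {0..T} f"
      using V'_int f_int
    proof (rule has_integral_le)
      fix t assume "t \<in> {0..T}"
      then show "- V' t \<le> f t" using dissipation[of t] by simp
    qed
    then have "ennreal (V 0 - V T) \<le> ennreal (integral {0..T} f)" by (rule ennreal_leI)
    also have "\<dots> = (\<integral>\<^sup>+t\<in>{0..T}. ennreal (f t) \<partial>lborel)"
      using f_int by (subst nn_integral_has_integral_lebesgue') (auto intro: nonneg)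
    also have "\<dots> \<le> ?J"
      by (intro nn_integral_mono) (auto simp: indicator_def)
    finally show ?thesis .
  qed
  have "((\<lambda>T. ennreal (V 0 - V T)) \<longlongrightarrow> ennreal (V 0 - 0)) at_top"
    by (intro tendsto_ennrealI tendsto_intros V)
  moreover have "\<forall>\<^sub>F T in at_top. ennreal (V 0 - V T) \<le> ?J"
    using eventually_ge_at_top[of 0] by eventually_elim (rule bound)
  ultimately have "ennreal (V 0 - 0) \<le> ?J"
    by (rule tendsto_upperbound) simp
  then show ?thesis by simp
qed

section \<open>Block matrices indexed by players\<close>

lemma split_vec:
  assumes "u \<in> carrier_vec (a + b)"
  obtains v w where "u = v @\<^sub>v w" "v \<in> carrier_vec a" "w \<in> carrier_vec b"
  by (rule that[OF vec_first_last_append[OF assms, symmetric]]) simp_all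

text \<open>Prepending a block to a row of blocks: the two lower blocks have no rows and contribute nothing.\<close>

lemma four_block_row_mult_append:
  fixes M :: "'a :: comm_ring_1 Matrix.mat"
  assumes M: "M \<in> carrier_mat n a" and H: "H \<in> carrier_mat n b"
    and u: "u \<in> carrier_vec a" and w: "w \<in> carrier_vec b"
  shows "four_block_mat M H (0\<^sub>m 0 a) (0\<^sub>m 0 b) *\<^sub>v (u @\<^sub>v w) = M *\<^sub>v u + H *\<^sub>v w"
proof -
  have "four_block_mat M H (0\<^sub>m 0 a) (0\<^sub>m 0 b) *\<^sub>v (u @\<^sub>v w)
      = (M *\<^sub>v u + H *\<^sub>v w) @\<^sub>v (0\<^sub>m 0 a *\<^sub>v u + 0\<^sub>m 0 b *\<^sub>v w)"
    using M H u w by (intro four_block_mat_mult_vec) auto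
  also have "\<dots> = M *\<^sub>v u + H *\<^sub>v w"
    using M H by (intro eq_vecI) auto
  finally show ?thesis .
qed

lemma hconcat_mat_carrier:
  assumes "\<And>j. j \<in> set js \<Longrightarrow> Ms j \<in> carrier_mat n (d j)"
  shows "hconcat_mat n (map Ms js) \<in> carrier_mat n (sum_list (map d js))"
  using assms
proof (induction js)
  case (Cons j js)
  have "Ms j \<in> carrier_mat n (d j)" using Cons.prems by simp
  moreover have "hconcat_mat n (map Ms js) \<in> carrier_mat n (sum_list (map d js))"
    using Cons by simp
  ultimately show ?case
    using four_block_carrier_mat[of "Ms j" n "d j" "0\<^sub>m 0 (sum_list (map d js))" 0] by simp
qed simp

text \<open>The selector of player \<open>i\<close> for an arbitrary list of players, so that facts about it can be proved by
induction on the list.\<close>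

definition block_selector :: "(nat \<Rightarrow> nat) \<Rightarrow> nat \<Rightarrow> nat list \<Rightarrow> rmat" where
  "block_selector m i js =
     hconcat_mat (m i) (map (\<lambda>j. if j = i then 1\<^sub>m (m i) else 0\<^sub>m (m i) (m j)) js)"

lemma block_selector_carrier: "block_selector m i js \<in> carrier_mat (m i) (sum_list (map m js))"
  unfolding block_selector_def by (rule hconcat_mat_carrier) auto

lemma block_selector_Cons_append:
  assumes u: "u \<in> carrier_vec (m j)" and w: "w \<in> carrier_vec (sum_list (map m js))"
  shows "block_selector m i (j # js) *\<^sub>v (u @\<^sub>v w)
    = (if j = i then u else 0\<^sub>v (m i)) + block_selector m i js *\<^sub>v w"
proof -
  let ?M = "if j = i then 1\<^sub>m (m i) else 0\<^sub>m (m i) (m j) :: rmat"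
  have M: "?M \<in> carrier_mat (m i) (m j)" by simp
  have "block_selector m i (j # js) *\<^sub>v (u @\<^sub>v w) = ?M *\<^sub>v u + block_selector m i js *\<^sub>v w"
    using four_block_row_mult_append[OF M block_selector_carrier u w] M
      block_selector_carrier[of m i js]
    by (simp add: block_selector_def)
  also have "?M *\<^sub>v u = (if j = i then u else 0\<^sub>v (m i))"
    using u by (auto intro!: eq_vecI)
  finally show ?thesis .
qed

lemma block_selector_notin:
  assumes "i \<notin> set js" and "u \<in> carrier_vec (sum_list (map m js))"
  shows "block_selector m i js *\<^sub>v u = 0\<^sub>v (m i)"
  using assms
proof (induction js arbitrary: u)
  case Nil
  then show ?case by (auto simp: block_selector_def scalar_prod_def intro!: eq_vecI)
next
  case (Cons j js)
  have "u \<in> carrier_vec (m j + sum_list (map m js))" using Cons.prems by simp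
  then obtain v w where "u = v @\<^sub>v w" "v \<in> carrier_vec (m j)" "w \<in> carrier_vec (sum_list (map m js))"
    using split_vec[of u "m j" "sum_list (map m js)"] by auto
  then show ?case using Cons by (simp add: block_selector_Cons_append)
qed

lemma quad_form_diag_block_Cons:
  assumes M: "M \<in> carrier_mat a a" and D: "diag_block_mat Ms \<in> carrier_mat b b"
    and u: "u \<in> carrier_vec a" and w: "w \<in> carrier_vec b"
  shows "quad_form (diag_block_mat (M # Ms)) (u @\<^sub>v w) = quad_form M u + quad_form (diag_block_mat Ms) w"
proof -
  have "diag_block_mat (M # Ms) *\<^sub>v (u @\<^sub>v w) = M *\<^sub>v u @\<^sub>v diag_block_mat Ms *\<^sub>v w"
    using mult_mat_vec_split[OF M D u w] M D by (simp add: Let_def)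
  then show ?thesis
    unfolding quad_form_def
    using scalar_prod_append[OF u w mult_mat_vec_carrier[OF M u] mult_mat_vec_carrier[OF D w]]
    by simp
qed

lemma diag_block_mat_carrier:
  assumes "\<And>j. j \<in> set js \<Longrightarrow> R j \<in> carrier_mat (m j) (m j)"
  shows "diag_block_mat (map R js) \<in> carrier_mat (sum_list (map m js)) (sum_list (map m js))"
proof -
  have "map (\<lambda>j. dim_row (R j)) js = map m js" "map (\<lambda>j. dim_col (R j)) js = map m js"
    using assms by auto
  then show ?thesis
    by (intro carrier_matI) (simp_all add: dim_diag_block_mat comp_def del: map_eq_conv)
qed

text \<open>This is what makes \<open>u' R u\<close> the sum of the control costs of the players. Distinctness is needed: the
selector of a repeated player would add up all of its blocks.\<close>

lemma quad_form_diag_block_mat: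
  assumes "distinct js" and "\<And>j. j \<in> set js \<Longrightarrow> R j \<in> carrier_mat (m j) (m j)"
    and "u \<in> carrier_vec (sum_list (map m js))"
  shows "quad_form (diag_block_mat (map R js)) u
    = (\<Sum>i\<leftarrow>js. quad_form (R i) (block_selector m i js *\<^sub>v u))"
  using assms
proof (induction js arbitrary: u)
  case Nil
  then show ?case by (simp add: quad_form_def scalar_prod_def)
next
  case (Cons j js)
  have "u \<in> carrier_vec (m j + sum_list (map m js))" using Cons.prems by simp
  then obtain v w where u: "u = v @\<^sub>v w" and v: "v \<in> carrier_vec (m j)"
    and w: "w \<in> carrier_vec (sum_list (map m js))"
    using split_vec[of u "m j" "sum_list (map m js)"] by auto
  have Rj: "R j \<in> carrier_mat (m j) (m j)" using Cons.prems by simp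
  have D: "diag_block_mat (map R js) \<in> carrier_mat (sum_list (map m js)) (sum_list (map m js))"
    using Cons.prems by (intro diag_block_mat_carrier) auto
  have "block_selector m j (j # js) *\<^sub>v u = v"
    using Cons.prems v w by (simp add: u block_selector_Cons_append block_selector_notin)
  moreover have "block_selector m i (j # js) *\<^sub>v u = block_selector m i js *\<^sub>v w"
    if "i \<in> set js" for i
  proof -
    have "block_selector m i js *\<^sub>v w \<in> carrier_vec (m i)"
      using block_selector_carrier w by (rule mult_mat_vec_carrier)
    moreover have "i \<noteq> j" using that Cons.prems(1) by auto
    ultimately show ?thesis using v w by (simp add: u block_selector_Cons_append)
  qed
  ultimately have "(\<Sum>i\<leftarrow>j # js. quad_form (R i) (block_selector m i (j # js) *\<^sub>v u))
      = quad_form (R j) v + (\<Sum>i\<leftarrow>js. quad_form (R i) (block_selector m i js *\<^sub>v w))"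
    by (simp cong: map_cong)
  also have "\<dots> = quad_form (R j) v + quad_form (diag_block_mat (map R js)) w"
    using Cons w by simp
  also have "\<dots> = quad_form (diag_block_mat (map R (j # js))) u"
    using quad_form_diag_block_Cons[OF Rj D v w] by (simp only: u list.map)
  finally show ?case by simp
qed

lemma pos_def_diag_block_mat:
  assumes "\<And>j. j \<in> set js \<Longrightarrow> pos_def (m j) (R j)"
  shows "pos_def (sum_list (map m js)) (diag_block_mat (map R js))"
  using assms
proof (induction js)
  case Nil
  then show ?case by (auto simp: pos_def_def)
next
  case (Cons j js)
  have Rj: "pos_def (m j) (R j)" and D: "pos_def (sum_list (map m js)) (diag_block_mat (map R js))"
    using Cons by auto
  then have carriers: "R j \<in> carrier_mat (m j) (m j)"
      "diag_block_mat (map R js) \<in> carrier_mat (sum_list (map m js)) (sum_list (map m js))"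
    and sym: "transpose_mat (R j) = R j"
      "transpose_mat (diag_block_mat (map R js)) = diag_block_mat (map R js)"
    by (auto simp: pos_def_def)
  have "diag_block_mat (map R (j # js))
      \<in> carrier_mat (sum_list (map m (j # js))) (sum_list (map m (j # js)))"
    using Cons.prems by (intro diag_block_mat_carrier) (auto simp: pos_def_def)
  moreover have "transpose_mat (diag_block_mat (map R (j # js))) = diag_block_mat (map R (j # js))"
    using carriers sym
    by (simp add: Let_def transpose_four_block_mat[of _ "m j" "m j" _ "sum_list (map m js)" _ "sum_list (map m js)"])
  moreover have "0 < quad_form (diag_block_mat (map R (j # js))) u"
    if u: "u \<in> carrier_vec (sum_list (map m (j # js)))" and nz: "u \<noteq> 0\<^sub>v (sum_list (map m (j # js)))" for u
  proof -
    obtain v w where u_eq: "u = v @\<^sub>v w" and v: "v \<in> carrier_vec (m j)"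
      and w: "w \<in> carrier_vec (sum_list (map m js))"
      using u split_vec[of u "m j" "sum_list (map m js)"] by auto
    have "v \<noteq> 0\<^sub>v (m j) \<or> w \<noteq> 0\<^sub>v (sum_list (map m js))"
      using nz by (auto simp: u_eq)
    then have "0 < quad_form (R j) v + quad_form (diag_block_mat (map R js)) w"
      using pos_def_quad_form_nonneg[OF Rj v] pos_def_quad_form_nonneg[OF D w] Rj D v w
      by (auto simp: pos_def_def intro: add_pos_nonneg add_nonneg_pos)
    then show ?thesis
      using quad_form_diag_block_Cons[OF carriers v w] by (simp only: u_eq list.map)
  qed
  ultimately show ?case unfolding pos_def_def by blast
qed

lemma input_dim_eq_sum_list: "input_dim N m = sum_list (map m [1..<Suc N])"
  by (simp add: input_dim_def sum_list_distinct_conv_sum_set atLeastLessThanSuc_atLeastAtMost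
      del: upt_Suc)

lemma joint_B_carrier:
  assumes "\<And>i. i \<in> {1..N} \<Longrightarrow> B i \<in> carrier_mat n (m i)"
  shows "joint_B N n B \<in> carrier_mat n (input_dim N m)"
  unfolding joint_B_def input_dim_eq_sum_list
  using assms by (intro hconcat_mat_carrier) auto

section \<open>Comparison with the cooperative optimum\<close>

text \<open>The storage function along the closed loop of \<open>F\<close> starts at \<open>x0' P x0\<close>, tends to zero, and
decreases no faster than the players spend jointly.\<close>

lemma total_cost_ge_cooperative_cost:
  assumes A: "A \<in> carrier_mat n n"
    and B: "\<And>i. i \<in> {1..N} \<Longrightarrow> B i \<in> carrier_mat n (m i)"
    and C: "\<And>i. i \<in> {1..N} \<Longrightarrow> C i \<in> carrier_mat (s i) n"
    and Q: "\<And>i. i \<in> {1..N} \<Longrightarrow> pos_semidef (s i) (Q i)"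
    and R: "\<And>i. i \<in> {1..N} \<Longrightarrow> pos_def (m i) (R i)"
    and P: "pos_def n P"
    and are: "stabilizing_are_solution n A (joint_B N n B) (Q_coop N n C Q) (R_coop N R) P"
    and x0: "x0 \<in> carrier_vec n"
    and F: "F \<in> carrier_mat (input_dim N m) n" and stable: "hurwitz (A + joint_B N n B * F)"
  shows "ennreal (quad_form P x0) \<le> (\<Sum>i = 1..N. player_cost N n m A B C Q R i x0 F)"
proof -
  let ?p = "input_dim N m" and ?js = "[1..<Suc N]"
  have p: "?p = sum_list (map m ?js)"
    by (rule input_dim_eq_sum_list)
  have sum_players: "(\<Sum>i\<leftarrow>?js. f i) = (\<Sum>i = 1..N. f i)" for f :: "nat \<Rightarrow> real"
    by (simp add: sum_list_distinct_conv_sum_set atLeastLessThanSuc_atLeastAtMost del: upt_Suc)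
  have sel: "selector N m i = block_selector m i ?js" for i
    by (simp add: selector_def block_selector_def)
  have sel_carrier: "selector N m i \<in> carrier_mat (m i) ?p" for i
    unfolding sel p by (rule block_selector_carrier)
  have joint_B: "joint_B N n B \<in> carrier_mat n ?p"
    using B by (rule joint_B_carrier)
  have R_pos: "pos_def ?p (R_coop N R)"
    unfolding R_coop_def p using R by (intro pos_def_diag_block_mat) auto
  have Q_carrier: "Q_coop N n C Q \<in> carrier_mat n n" by (simp add: Q_coop_def)
  have Pc: "P \<in> carrier_mat n n" "transpose_mat P = P" using P by (auto simp: pos_def_def)
  let ?M = "A + joint_B N n B * F"
  have M: "?M \<in> carrier_mat n n" using A joint_B F by simp
  define x where "x = trajectory n ?M x0"
  have sol: "linear_ode_solution n ?M x0 x"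
    unfolding x_def by (rule trajectory_solves[OF M x0])
  have x: "x t \<in> carrier_vec n" if "0 \<le> t" for t
    using sol that by (simp add: linear_ode_solution_def)
  have x_cont: "continuous_on {0..} (\<lambda>t. x t $ j)" if "j < n" for j
    by (rule DERIV_continuous_on[where D = "\<lambda>t. (?M *\<^sub>v x t) $ j"])
      (use sol that in \<open>simp add: linear_ode_solution_def\<close>)
  have cost_carrier: "transpose_mat (C i) * Q i * C i \<in> carrier_mat n n" if "i \<in> {1..N}" for i
    using C[OF that] Q[OF that] by (auto simp: pos_semidef_def intro!: mult_carrier_mat[of _ n "s i"])
  define f where "f i t = quad_form (transpose_mat (C i) * Q i * C i) (x t)
      + quad_form (R i) (selector N m i * F *\<^sub>v x t)" for i t
  have f_nonneg: "0 \<le> f i t" if "i \<in> {1..N}" "0 \<le> t" for i t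
  proof -
    have "quad_form (transpose_mat (C i) * Q i * C i) (x t) = quad_form (Q i) (C i *\<^sub>v x t)"
      using C[OF that(1)] Q[OF that(1)] x[OF that(2)]
      by (intro quad_form_congruence) (auto simp: pos_semidef_def)
    moreover have "0 \<le> quad_form (Q i) (C i *\<^sub>v x t)"
      using Q[OF that(1)] C[OF that(1)] x[OF that(2)] by (auto simp: pos_semidef_def)
    moreover have "0 \<le> quad_form (R i) (selector N m i * F *\<^sub>v x t)"
      using R[OF that(1)] sel_carrier[of i] F x[OF that(2)]
      by (intro pos_def_quad_form_nonneg[of "m i"]) auto
    ultimately show ?thesis by (simp add: f_def)
  qed
  have f_cont: "continuous_on {0..} (f i)" if i: "i \<in> {1..N}" for i
  proof -
    have "continuous_on {0..} (\<lambda>t. quad_form (transpose_mat (C i) * Q i * C i) (1\<^sub>m n *\<^sub>v x t))"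
      using C[OF i] Q[OF i] x x_cont
      by (intro continuous_on_quad_form) (auto simp: pos_semidef_def)
    then have "continuous_on {0..} (\<lambda>t. quad_form (transpose_mat (C i) * Q i * C i) (x t))"
      by (rule continuous_on_eq) (use x in auto)
    moreover have "continuous_on {0..} (\<lambda>t. quad_form (R i) (selector N m i * F *\<^sub>v x t))"
      using R[OF i] sel_carrier[of i] F x x_cont
      by (intro continuous_on_quad_form) (auto simp: pos_def_def)
    ultimately show ?thesis unfolding f_def by (rule continuous_on_add)
  qed
  have total: "(\<Sum>i = 1..N. f i t) = quad_form (Q_coop N n C Q) (x t) + quad_form (R_coop N R) (F *\<^sub>v x t)"
    if t: "0 \<le> t" for t
  proof -
    have Fx: "F *\<^sub>v x t \<in> carrier_vec ?p" using F x[OF t] by simp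
    have "quad_form (Q_coop N n C Q) (x t) = (\<Sum>i = 1..N. quad_form (transpose_mat (C i) * Q i * C i) (x t))"
      unfolding Q_coop_def by (intro quad_form_mat_sum cost_carrier x[OF t])
    moreover have "quad_form (R_coop N R) (F *\<^sub>v x t)
        = (\<Sum>i = 1..N. quad_form (R i) (selector N m i *\<^sub>v (F *\<^sub>v x t)))"
      unfolding R_coop_def sel sum_players[symmetric]
      using R Fx[unfolded p] by (intro quad_form_diag_block_mat) (auto simp: pos_def_def)
    moreover have "selector N m i *\<^sub>v (F *\<^sub>v x t) = selector N m i * F *\<^sub>v x t" for i
      using sel_carrier F x[OF t] by (simp add: assoc_mult_mat_vec[of _ "m i" ?p _ n])
    ultimately show ?thesis by (simp add: f_def sum.distrib)
  qed
  have "ennreal (quad_form P (x 0)) \<le> (\<integral>\<^sup>+t\<in>{0..}. ennreal (\<Sum>i = 1..N. f i t) \<partial>lborel)"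
  proof (rule dissipation_lower_bound)
    show "((\<lambda>t. quad_form P (x t)) has_real_derivative 2 * (x t \<bullet> (P *\<^sub>v (?M *\<^sub>v x t)))) (at t within {0..})"
      if "0 \<le> t" for t
      by (rule quad_form_derivative[OF Pc M sol that])
    show "continuous_on {0..} (\<lambda>t. \<Sum>i = 1..N. f i t)"
      by (intro continuous_on_sum f_cont)
    show "0 \<le> (\<Sum>i = 1..N. f i t)" if "0 \<le> t" for t
      using that by (intro sum_nonneg f_nonneg)
    show "((\<lambda>t. quad_form P (x t)) \<longlongrightarrow> 0) at_top"
      by (rule quad_form_tendsto_zero[OF Pc(1) x hurwitz_ode_tendsto_zero[OF M stable sol]])
    show "0 \<le> 2 * (x t \<bullet> (P *\<^sub>v (?M *\<^sub>v x t))) + (\<Sum>i = 1..N. f i t)" if t: "0 \<le> t" for t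
    proof -
      have "?M *\<^sub>v x t = A *\<^sub>v x t + joint_B N n B *\<^sub>v (F *\<^sub>v x t)"
        using A joint_B F x[OF t]
        by (simp add: add_mult_distrib_mat_vec[of _ n n] assoc_mult_mat_vec[of _ n ?p _ n])
      moreover have "F *\<^sub>v x t \<in> carrier_vec ?p" using F x[OF t] by simp
      ultimately show ?thesis
        using are_dissipation_inequality[OF A joint_B Q_carrier R_pos P _ x[OF t]] are total[OF t]
        by (simp add: stabilizing_are_solution_def)
    qed
  qed
  also have "x 0 = x0" using sol by (simp add: linear_ode_solution_def)
  also have "(\<integral>\<^sup>+t\<in>{0..}. ennreal (\<Sum>i = 1..N. f i t) \<partial>lborel)
      = (\<integral>\<^sup>+t. (\<Sum>i = 1..N. ennreal (f i t) * indicator {0..} t) \<partial>lborel)"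
  proof (rule nn_integral_cong)
    fix t :: real
    show "ennreal (\<Sum>i = 1..N. f i t) * indicator {0..} t
        = (\<Sum>i = 1..N. ennreal (f i t) * indicator {0..} t)"
    proof (cases "0 \<le> t")
      case True
      then have "(\<Sum>i = 1..N. ennreal (f i t)) = ennreal (\<Sum>i = 1..N. f i t)"
        by (intro sum_ennreal f_nonneg)
      then show ?thesis using True by simp
    qed simp
  qed
  also have "\<dots> = (\<Sum>i = 1..N. \<integral>\<^sup>+t\<in>{0..}. ennreal (f i t) \<partial>lborel)"
  proof (rule nn_integral_sum)
    fix i assume i: "i \<in> {1..N}"
    have "(\<lambda>t. ennreal (indicator {0..} t *\<^sub>R f i t)) \<in> borel_measurable lborel"
      using borel_measurable_continuous_on_indicator[OF _ f_cont[OF i]] by simp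
    also have "(\<lambda>t. ennreal (indicator {0..} t *\<^sub>R f i t)) = (\<lambda>t. ennreal (f i t) * indicator {0..} t)"
      by (auto simp: indicator_def)
    finally show "(\<lambda>t. ennreal (f i t) * indicator {0..} t) \<in> borel_measurable lborel" .
  qed
  also have "\<dots> = (\<Sum>i = 1..N. player_cost N n m A B C Q R i x0 F)"
    by (simp add: player_cost_def Let_def f_def x_def)
  finally show ?thesis .
qed

lemma cost_ratio_ge_one:
  assumes "ennreal (quad_form P x0) \<le> (\<Sum>i = 1..N. player_cost N n m A B C Q R i x0 F)"
    and "0 < quad_form P x0"
  shows "1 \<le> cost_ratio N n m A B C Q R P x0 F"
  using divide_right_mono_ennreal[OF assms(1), of "ennreal (quad_form P x0)"] assms(2)
  by (simp add: cost_ratio_def ennreal_divide_self)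

theorem lemma3:
  fixes N n :: nat and m s :: "nat \<Rightarrow> nat" and r :: real
    and A P :: "real Matrix.mat" and B C Q R :: "nat \<Rightarrow> real Matrix.mat"
    and x0 :: "real Matrix.vec"
  assumes A: "A \<in> carrier_mat n n"
    and B: "\<And>i. i \<in> {1..N} \<Longrightarrow> B i \<in> carrier_mat n (m i)"
    and C: "\<And>i. i \<in> {1..N} \<Longrightarrow> C i \<in> carrier_mat (s i) n"
    and rank_C: "\<And>i. i \<in> {1..N} \<Longrightarrow> vec_space.rank (s i) (C i) = s i"
    and s_le: "\<And>i. i \<in> {1..N} \<Longrightarrow> s i \<le> n"
    and Q: "\<And>i. i \<in> {1..N} \<Longrightarrow> pos_semidef (s i) (Q i)"
    and R: "\<And>i. i \<in> {1..N} \<Longrightarrow> pos_def (m i) (R i)"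
    and stabilizable: "stabilizable n (input_dim N m) A (joint_B N n B)"
    and P_pos: "pos_def n P"
    and P_are: "stabilizing_are_solution n A (joint_B N n B) (Q_coop N n C Q) (R_coop N R) P"
    and r: "r > 0"
    and x0: "x0 \<in> vball n r" "x0 \<noteq> 0\<^sub>v n"
  shows
    "(\<forall>\<alpha> \<in> weights N. \<forall>P\<^sub>\<alpha>.
        pos_def n P\<^sub>\<alpha> \<and>
        stabilizing_are_solution n A (joint_B N n B) (Q_weighted N n C Q \<alpha>) (R_weighted N R \<alpha>) P\<^sub>\<alpha> \<and>
        output_structured N n m C
          (minv (R_weighted N R \<alpha>) * transpose_mat (joint_B N n B) * P\<^sub>\<alpha>) \<longrightarrow>
        cost_ratio N n m A B C Q R P x0
          (- (minv (R_weighted N R \<alpha>) * transpose_mat (joint_B N n B) * P\<^sub>\<alpha>)) \<ge> 1)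
     \<and>
     (\<forall>\<alpha> \<in> weights N. \<forall>\<delta> > 0. \<forall>F\<^sub>s \<in> carrier_mat (input_dim N m) n.
        output_structured N n m C F\<^sub>s \<and>
        (\<forall>z \<in> vball n r. weighted_cost N n m A B C Q R \<alpha> z F\<^sub>s < ennreal \<delta>) \<and>
        hurwitz (A + joint_B N n B * F\<^sub>s) \<longrightarrow>
        cost_ratio N n m A B C Q R P x0 F\<^sub>s \<ge> 1)"
proof -
  let ?p = "input_dim N m" and ?B = "joint_B N n B"
  have x0_carrier: "x0 \<in> carrier_vec n" using x0 by (simp add: vball_def)
  have ratio: "1 \<le> cost_ratio N n m A B C Q R P x0 F"
    if F: "F \<in> carrier_mat ?p n" and stable: "hurwitz (A + ?B * F)" for F
  proof (rule cost_ratio_ge_one)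
    show "0 < quad_form P x0" using P_pos x0_carrier x0(2) by (simp add: pos_def_def)
  qed (rule total_cost_ge_cooperative_cost[OF A B C Q R P_pos P_are x0_carrier F stable])
  have p: "?p = sum_list (map m [1..<Suc N])"
    by (rule input_dim_eq_sum_list)
  have Bc: "?B \<in> carrier_mat n ?p"
    using B by (rule joint_B_carrier)
  have pareto: "1 \<le> cost_ratio N n m A B C Q R P x0 (- (minv (R_weighted N R \<alpha>) * transpose_mat ?B * P\<^sub>\<alpha>))"
    if \<alpha>: "\<alpha> \<in> weights N" and P\<alpha>: "pos_def n P\<^sub>\<alpha>"
      and are: "stabilizing_are_solution n A ?B (Q_weighted N n C Q \<alpha>) (R_weighted N R \<alpha>) P\<^sub>\<alpha>"
    for \<alpha> P\<^sub>\<alpha>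
  proof (rule ratio)
    let ?S = "minv (R_weighted N R \<alpha>)"
    have "pos_def ?p (R_weighted N R \<alpha>)"
      unfolding R_weighted_def p
      using \<alpha> R by (intro pos_def_diag_block_mat pos_def_smult) (auto simp: weights_def)
    then have S: "?S \<in> carrier_mat ?p ?p" by (rule pos_def_minv)
    have P\<alpha>c: "P\<^sub>\<alpha> \<in> carrier_mat n n" using P\<alpha> by (simp add: pos_def_def)
    have K: "?S * transpose_mat ?B * P\<^sub>\<alpha> \<in> carrier_mat ?p n" using S Bc P\<alpha>c by simp
    then show "- (?S * transpose_mat ?B * P\<^sub>\<alpha>) \<in> carrier_mat ?p n" by simp
    \<comment> \<open>The gain is chosen so that its closed loop is the matrix that a stabilizing solution makes Hurwitz.\<close>
    have "A + ?B * - (?S * transpose_mat ?B * P\<^sub>\<alpha>) = A - ?B * ?S * transpose_mat ?B * P\<^sub>\<alpha>"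
    proof -
      have "?B * - (?S * transpose_mat ?B * P\<^sub>\<alpha>) = - (?B * (?S * transpose_mat ?B * P\<^sub>\<alpha>))"
        using Bc K by (intro uminus_mult_right_mat) auto
      also have "?B * (?S * transpose_mat ?B * P\<^sub>\<alpha>) = ?B * ?S * transpose_mat ?B * P\<^sub>\<alpha>"
        using Bc S P\<alpha>c
        by (simp add: assoc_mult_mat[of _ n ?p _ n _ n] assoc_mult_mat[of _ n ?p _ ?p _ n]
          assoc_mult_mat[of _ ?p ?p _ n _ n])
      finally have "?B * - (?S * transpose_mat ?B * P\<^sub>\<alpha>) = - (?B * ?S * transpose_mat ?B * P\<^sub>\<alpha>)" .
      moreover have "?B * ?S * transpose_mat ?B * P\<^sub>\<alpha> \<in> carrier_mat n n"
        using Bc S P\<alpha>c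
        by (intro mult_carrier_mat[of _ n n] mult_carrier_mat[of _ n ?p]) auto
      ultimately show ?thesis by (simp only: minus_add_uminus_mat[OF A])
    qed
    then show "hurwitz (A + ?B * - (?S * transpose_mat ?B * P\<^sub>\<alpha>))"
      using are by (simp add: stabilizing_are_solution_def)
  qed
  show ?thesis using ratio pareto by blast
qed

end
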